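(* Let $R$ be a finite non-identity group (that is, $|R| \ge 2$). Then the number of subgroups of $R$ is at most $$7.3722\cdot |R|^{\frac{\log_2 |R|}{4}+1.5315}.$$
   Context: $|R|$ denotes the order of $R$. All subgroups of $R$ are counted (not merely up to conjugacy or isomorphism), including the trivial subgroup and $R$ itself. The constants $7.3722$ and $1.5315$ are exact decimal numbers. *)

theory Defs
  imports Complex_Main "HOL-Algebra.Group" "HOL-Algebra.Coset"
begin

end

theory Submission
  imports Defs "HOL-Algebra.Generated_Groups"
begin

text \<open>
  Fix a subgroup \<open>K\<close> of \<open>R\<close> and an order \<open>h\<close>. Double counting the pairs \<open>(x, H)\<close> with
  \<open>K < H\<close>, \<open>|H| = h\<close> and \<open>x \<in> H - K\<close> bounds \<open>h / 2\<close> times the number of such \<open>H\<close> by the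
  sum over \<open>x\<close> of the number of subgroups of order \<open>h\<close> above \<open>\<langle>K, x\<rangle>\<close>, because
  \<open>|H - K| \<ge> h / 2\<close>. As \<open>|\<langle>K, x\<rangle>| \<ge> 2 |K|\<close>, iterating at most \<open>log 2 h\<close> times from the trivial
  subgroup yields at most \<open>(2 |R| / h) powr log 2 h\<close> subgroups of order \<open>h\<close>. With \<open>s = log 2 h\<close>
  and \<open>L = log 2 |R|\<close> the exponent \<open>s * (L + 1 - s)\<close> of \<open>2\<close> is at most \<open>(L + 1)\<^sup>2 / 4\<close>, and
  there are at most \<open>|R|\<close> orders \<open>h\<close>.
\<close>

text \<open>For \<open>x\<close> in \<open>L\<close> but not in \<open>K\<close>, the left coset of
  \<open>K\<close> by \<open>x\<close> lies in \<open>L\<close>, is as large as \<open>K\<close> and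
  misses \<open>K\<close>.\<close>

lemma (in group) card_proper_subgroup:
  assumes "subgroup K G" "subgroup L G" "K \<subset> L" "finite L"
  shows "2 * card K \<le> card L"
proof -
  obtain x where x: "x \<in> L" "x \<notin> K" using assms(3) by blast
  interpret K: subgroup K G by fact
  interpret L: subgroup L G by fact
  have xc: "x \<in> carrier G" using x by (rule_tac L.mem_carrier)
  have inj: "inj_on (\<lambda>k. x \<otimes> k) K"
    using xc by (intro inj_onI) (simp add: K.mem_carrier)
  have disj: "(\<lambda>k. x \<otimes> k) ` K \<inter> K = {}"
  proof -
    have "x \<in> K" if "k \<in> K" "x \<otimes> k \<in> K" for k
    proof -
      have "x = (x \<otimes> k) \<otimes> inv k"
        using xc that by (simp add: K.mem_carrier m_assoc)
      also have "\<dots> \<in> K" using that by blast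
      finally show ?thesis .
    qed
    then show ?thesis using x(2) by blast
  qed
  have sub: "(\<lambda>k. x \<otimes> k) ` K \<union> K \<subseteq> L"
    using x(1) assms(3) by auto
  have finK: "finite K" using assms(3,4) finite_subset by blast
  have "2 * card K = card ((\<lambda>k. x \<otimes> k) ` K \<union> K)"
    using disj inj finK by (simp add: card_Un_disjoint card_image)
  also have "\<dots> \<le> card L" using sub assms(4) by (rule_tac card_mono)
  finally show ?thesis .
qed

lemma (in group) finite_subgroups:
  assumes "finite (carrier G)"
  shows "finite {H. subgroup H G \<and> P H}"
  by (rule finite_subset[of _ "Pow (carrier G)"]) (use assms subgroup.subset in auto)

text \<open>The number \<open>m\<close> bounds how often \<open>K\<close> can still be enlarged
  properly inside a subgroup of order \<open>h\<close>, since each enlargement at least doubles the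
  order. Each one costs a factor \<open>2 * order G / h\<close>; the denominators are cleared to
  stay in the natural numbers.\<close>

lemma (in group) card_subgroups_above:
  assumes fin: "finite (carrier G)" and "subgroup K G" and "h < 2 ^ Suc m * card K"
  shows "card {H. subgroup H G \<and> K \<subseteq> H \<and> card H = h} * h ^ m \<le> (2 * order G) ^ m"
  using assms(2,3)
proof (induction m arbitrary: K)
  \<comment> \<open>Here \<open>h < 2 * card K\<close> leaves no room for a proper overgroup of
    order \<open>h\<close>.\<close>
  case (0 K)
  have "H = K" if "subgroup H G" "K \<subseteq> H" "card H = h" for H
  proof (rule ccontr)
    assume "H \<noteq> K"
    then have "2 * card K \<le> card H"
      using that 0 finite_subset[OF subgroup.subset fin] by (intro card_proper_subgroup) auto
    then show False using that 0 by simp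
  qed
  then have "{H. subgroup H G \<and> K \<subseteq> H \<and> card H = h} \<subseteq> {K}" by blast
  then have "card {H. subgroup H G \<and> K \<subseteq> H \<and> card H = h} \<le> card {K}"
    by (intro card_mono) auto
  then show ?case by simp
next
  case (Suc m K)
  define S where "S K = {H. subgroup H G \<and> K \<subseteq> H \<and> card H = h}" for K
  have finH: "finite H" if "subgroup H G" for H
    using that fin by (rule finite_subset[OF subgroup.subset])
  have finS: "finite (S K)" for K
    unfolding S_def using fin by (rule finite_subgroups)
  have Kc: "K \<subseteq> carrier G" using Suc.prems(1) by (rule subgroup.subset)
  show ?case
  proof (cases "h = card K")
    \<comment> \<open>Only \<open>K\<close> itself can occur, and \<open>H - K\<close> would be
      empty, so double counting says nothing here.\<close>
    case True
    have "K = H" if "H \<in> S K" for H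
      using that True finH by (intro card_subset_eq) (auto simp: S_def)
    then have "S K \<subseteq> {K}" by blast
    then have "card (S K) \<le> 1"
      using card_mono[of "{K}" "S K"] by simp
    moreover have "h \<le> 2 * order G"
      using True card_mono[OF fin Kc] by (simp add: order_def)
    ultimately have "card (S K) * h ^ Suc m \<le> 1 * (2 * order G) ^ Suc m"
      by (intro mult_mono power_mono) auto
    then show ?thesis by (simp add: S_def)
  next
    case False
    have half: "h \<le> 2 * card (H - K)" if "H \<in> S K" for H
    proof -
      have H: "subgroup H G" "K \<subset> H" "card H = h" using that False by (auto simp: S_def)
      then have "2 * card K \<le> h" using card_proper_subgroup[of K H] Suc.prems finH by auto
      moreover have "card (H - K) = h - card K"
        using H finH[OF Suc.prems(1)] by (simp add: card_Diff_subset psubset_imp_subset)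
      ultimately show ?thesis by simp
    qed
    \<comment> \<open>Subgroups above \<open>K\<close> that contain \<open>x\<close> lie above
      \<open>?L\<close>, whose order is at least \<open>2 * card K\<close>. This doubling pays for
      the drop from \<open>Suc m\<close> to \<open>m\<close>.\<close>
    have step: "card {H \<in> S K. x \<in> H} * h ^ m \<le> (2 * order G) ^ m"
      if x: "x \<in> carrier G - K" for x
    proof -
      let ?L = "generate G (insert x K)"
      have L: "subgroup ?L G" using x Kc by (intro generate_is_subgroup) auto
      have sub: "insert x K \<subseteq> ?L" by (auto intro: generate.incl)
      have "2 * card K \<le> card ?L"
        using x sub Suc.prems(1) L finH[OF L] by (intro card_proper_subgroup) auto
      then have "2 ^ Suc m * (2 * card K) \<le> 2 ^ Suc m * card ?L" by (rule mult_le_mono2)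
      moreover have "h < 2 ^ Suc m * (2 * card K)" using Suc.prems(2) by simp
      ultimately have "h < 2 ^ Suc m * card ?L" by (rule less_le_trans[rotated])
      with L have "card (S ?L) * h ^ m \<le> (2 * order G) ^ m"
        unfolding S_def by (rule Suc.IH)
      moreover have "{H \<in> S K. x \<in> H} \<subseteq> S ?L"
        unfolding S_def using generate_subgroup_incl by blast
      then have "card {H \<in> S K. x \<in> H} \<le> card (S ?L)"
        using finS by (intro card_mono)
      ultimately show ?thesis
        by (meson le_trans mult_le_mono1)
    qed
    have "(\<Sum>H\<in>S K. card (H - K)) = (\<Sum>H\<in>S K. \<Sum>x\<in>carrier G - K. if x \<in> H then 1 else 0)"
    proof (rule sum.cong)
      fix H assume "H \<in> S K"
      then have "H - K = {x \<in> carrier G - K. x \<in> H}"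
        by (auto simp: S_def dest: subgroup.subset)
      then show "card (H - K) = (\<Sum>x\<in>carrier G - K. if x \<in> H then 1 else 0)"
        using fin by (simp add: sum.If_cases Int_def)
    qed simp
    also have "\<dots> = (\<Sum>x\<in>carrier G - K. \<Sum>H\<in>S K. if x \<in> H then 1 else 0)"
      by (rule sum.swap)
    also have "\<dots> = (\<Sum>x\<in>carrier G - K. card {H \<in> S K. x \<in> H})"
      using finS by (simp add: sum.If_cases Int_def)
    finally have double: "(\<Sum>H\<in>S K. card (H - K)) = (\<Sum>x\<in>carrier G - K. card {H \<in> S K. x \<in> H})" .
    have "card (S K) * h = (\<Sum>H\<in>S K. h)" by simp
    also have "\<dots> \<le> (\<Sum>H\<in>S K. 2 * card (H - K))" using half by (rule sum_mono)
    also have "\<dots> = 2 * (\<Sum>x\<in>carrier G - K. card {H \<in> S K. x \<in> H})"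
      by (simp add: double flip: sum_distrib_left)
    finally have "card (S K) * h * h ^ m \<le> 2 * (\<Sum>x\<in>carrier G - K. card {H \<in> S K. x \<in> H}) * h ^ m"
      by (rule mult_le_mono1)
    also have "\<dots> = 2 * (\<Sum>x\<in>carrier G - K. card {H \<in> S K. x \<in> H} * h ^ m)"
      by (simp add: sum_distrib_right)
    also have "\<dots> \<le> 2 * (\<Sum>x\<in>carrier G - K. (2 * order G) ^ m)"
      using step by (intro mult_le_mono2 sum_mono) blast
    \<comment> \<open>The factor 2 from \<open>half\<close> and the at most \<open>order G\<close>
      choices of \<open>x\<close> supply the missing factor \<open>2 * order G\<close>.\<close>
    also have "\<dots> \<le> 2 * (order G * (2 * order G) ^ m)"
      using fin by (simp add: order_def card_mono)
    finally show ?thesis by (simp add: S_def mult.assoc)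
  qed
qed

lemma (in group) card_subgroups_of_order:
  assumes fin: "finite (carrier G)" and h: "h \<ge> 1"
  defines "L \<equiv> log 2 (real (order G))"
  shows "real (card {H. subgroup H G \<and> card H = h}) \<le> 2 powr ((L + 1)\<^sup>2 / 4)"
proof (cases "{H. subgroup H G \<and> card H = h} = {}")
  case True
  then show ?thesis by (simp only: card.empty) simp
next
  case False
  then obtain H where "subgroup H G" "card H = h" by blast
  then have hn: "h \<le> order G"
    unfolding order_def using fin card_mono subgroup.subset by blast
  define n where "n = order G"
  define s where "s = log 2 (real h)"
  define N where "N = card {H. subgroup H G \<and> card H = h}"
  \<comment> \<open>This \<open>m\<close> is the floor of \<open>log 2 h\<close>; the upper bound is
    the premise of the counting lemma for the trivial subgroup.\<close>
  obtain m where m: "2 ^ m \<le> h" "h < 2 ^ Suc m"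
    using ex_power_ivl1[of 2 h] h by auto
  have "{H. subgroup H G \<and> {\<one>} \<subseteq> H \<and> card H = h} = {H. subgroup H G \<and> card H = h}"
    using subgroup.one_closed by auto
  then have "N * h ^ m \<le> (2 * n) ^ m"
    using card_subgroups_above[OF fin triv_subgroup, of h m] m by (simp add: N_def n_def)
  then have "real N * real h ^ m \<le> (2 * real n) ^ m"
    by (metis of_nat_le_iff of_nat_mult of_nat_numeral of_nat_power)
  then have "real N \<le> (2 * real n / real h) ^ m"
    using h by (simp add: power_divide pos_le_divide_eq)
  also have "\<dots> = (2 * real n / real h) powr real m"
    using h hn n_def by (subst powr_realpow) auto
  \<comment> \<open>The exponent may grow because \<open>h \<le> n\<close> makes the base at least
    1.\<close>
  also have "\<dots> \<le> (2 * real n / real h) powr s"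
  proof (rule powr_mono)
    show "real m \<le> s"
      unfolding s_def using m(1) h by (simp add: le_log_iff powr_realpow flip: of_nat_power)
    show "1 \<le> 2 * real n / real h" using h hn n_def by (simp add: field_simps)
  qed
  also have "2 * real n / real h = 2 powr (1 + L - s)"
    using h hn by (simp add: powr_add powr_diff L_def s_def n_def)
  also have "\<dots> powr s = 2 powr ((1 + L - s) * s)" by (rule powr_powr)
  also have "\<dots> \<le> 2 powr ((L + 1)\<^sup>2 / 4)"
  proof (rule powr_mono)
    have "0 \<le> (L + 1 - 2 * s)\<^sup>2" by simp
    then show "(1 + L - s) * s \<le> (L + 1)\<^sup>2 / 4"
      by (simp add: power2_eq_square algebra_simps)
  qed simp
  finally show ?thesis by (simp add: N_def)
qed

theorem theorem1p1:
  fixes R :: "('a, 'b) monoid_scheme"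
  assumes "group R" and "finite (carrier R)" and "order R \<ge> 2"
  shows "real (card {H. subgroup H R})
    \<le> 7.3722 * real (order R) powr (log 2 (real (order R)) / 4 + 1.5315)"
proof -
  interpret group R by fact
  define n where "n = real (order R)"
  define L where "L = log 2 n"
  have n: "n \<ge> 2" using assms(3) by (simp add: n_def)
  have n_eq: "n = 2 powr L" using n by (simp add: L_def)
  have "1 \<le> L" using n by (simp add: L_def)
  have "card H \<in> {1..order R}" if "subgroup H R" for H
  proof -
    have "H \<subseteq> carrier R" "\<one>\<^bsub>R\<^esub> \<in> H"
      using that by (rule subgroup.subset, rule subgroup.one_closed)
    moreover from this have "finite H" using assms(2) finite_subset by blast
    ultimately have "card H \<le> order R" "card H \<noteq> 0"
      using assms(2) by (auto simp: order_def card_mono)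
    then show ?thesis by simp
  qed
  then have eq: "{H. subgroup H R} = (\<Union>h\<in>{1..order R}. {H. subgroup H R \<and> card H = h})"
    by blast
  have "real (card {H. subgroup H R}) \<le> (\<Sum>h\<in>{1..order R}. real (card {H. subgroup H R \<and> card H = h}))"
    unfolding eq of_nat_sum[symmetric] of_nat_le_iff by (rule card_UN_le) simp
  also have "\<dots> \<le> (\<Sum>h\<in>{1..order R}. 2 powr ((L + 1)\<^sup>2 / 4))"
    using card_subgroups_of_order[OF assms(2)] by (intro sum_mono) (simp add: L_def n_def)
  \<comment> \<open>The number of summands is \<open>n = 2 powr L\<close>.\<close>
  also have "\<dots> = 2 powr (L + (L + 1)\<^sup>2 / 4)"
    by (simp add: powr_add n_eq[unfolded n_def, symmetric])
  \<comment> \<open>The left exponent expands to \<open>L * (L / 4 + 3 / 2) + 1 / 4\<close>, so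
    \<open>3 / 2 \<le> 1.5315\<close> and \<open>1 / 4 \<le> 1\<close> suffice.\<close>
  also have "\<dots> \<le> 2 powr (1 + L * (L / 4 + 1.5315))"
    using \<open>1 \<le> L\<close> by (intro powr_mono) (simp_all add: power2_eq_square field_simps)
  also have "\<dots> = 2 * n powr (L / 4 + 1.5315)"
    by (simp add: powr_add n_eq[symmetric] flip: powr_powr)
  also have "\<dots> \<le> 7.3722 * n powr (L / 4 + 1.5315)"
    by (intro mult_right_mono) simp_all
  finally show ?thesis by (simp add: n_def L_def)
qed

end
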